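(* There exists an NR ring that is not right Dischinger.
   Context: A ring is NR if its set of nilpotent elements is a subring (not necessarily containing $1$). An element $s$ of a ring $S$ is right strongly regular if $s=s^2t$ for some $t\in S$, left strongly regular if $s=ts^2$ for some $t\in S$, and strongly regular if both. A ring $S$ is right Dischinger if every right strongly regular element of $S$ is strongly regular. *)

theory Defs
  imports "HOL-Algebra.Algebra"
begin

definition nilpotent_elements :: "('a, 'b) ring_scheme \<Rightarrow> 'a set" where
  "nilpotent_elements R = {x \<in> carrier R. \<exists>n::nat. n \<ge> 1 \<and> x [^]\<^bsub>R\<^esub> n = \<zero>\<^bsub>R\<^esub>}"

(* The library's predicate subring also demands that \<one> is an element. *)
definition nonunital_subring :: "'a set \<Rightarrow> ('a, 'b) ring_scheme \<Rightarrow> bool" where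
  "nonunital_subring H R \<longleftrightarrow>
     additive_subgroup H R \<and> (\<forall>x\<in>H. \<forall>y\<in>H. x \<otimes>\<^bsub>R\<^esub> y \<in> H)"

definition NR_ring :: "('a, 'b) ring_scheme \<Rightarrow> bool" where
  "NR_ring R \<longleftrightarrow> ring R \<and> nonunital_subring (nilpotent_elements R) R"

definition right_strongly_regular :: "('a, 'b) ring_scheme \<Rightarrow> 'a \<Rightarrow> bool" where
  "right_strongly_regular R s \<longleftrightarrow>
     s \<in> carrier R \<and> (\<exists>t\<in>carrier R. s = s [^]\<^bsub>R\<^esub> (2::nat) \<otimes>\<^bsub>R\<^esub> t)"

definition left_strongly_regular :: "('a, 'b) ring_scheme \<Rightarrow> 'a \<Rightarrow> bool" where
  "left_strongly_regular R s \<longleftrightarrow>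
     s \<in> carrier R \<and> (\<exists>t\<in>carrier R. s = t \<otimes>\<^bsub>R\<^esub> s [^]\<^bsub>R\<^esub> (2::nat))"

definition strongly_regular :: "('a, 'b) ring_scheme \<Rightarrow> 'a \<Rightarrow> bool" where
  "strongly_regular R s \<longleftrightarrow> right_strongly_regular R s \<and> left_strongly_regular R s"

definition right_Dischinger :: "('a, 'b) ring_scheme \<Rightarrow> bool" where
  "right_Dischinger R \<longleftrightarrow>
     (\<forall>s\<in>carrier R. right_strongly_regular R s \<longrightarrow> strongly_regular R s)"

end

theory Submission
  imports Defs "HOL-Library.Poly_Mapping"
begin

text \<open>
  The ring is the universal one, \<open>S = \<int>\<langle>s, t | s\<^sup>2 t = s\<rangle>\<close>. Put \<open>p = s t\<close>, so that \<open>s p = s\<close>. Each word in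
  \<open>s\<close> and \<open>t\<close> reduces to a unique normal form \<open>w s\<^sup>k\<close> with \<open>w\<close> a word in \<open>t\<close> and \<open>p\<close>. These
  normal forms form a \<open>\<int>\<close>-basis of \<open>S\<close>; in particular \<open>S = F \<oplus> S s\<close>, where \<open>F\<close> is the free ring on
  \<open>t\<close> and \<open>p\<close>. Every element of \<open>S s\<^sup>2\<close> has only normal forms with \<open>k \<ge> 2\<close>, so \<open>s\<close> is right but not
  left strongly regular.

  It remains to see that the nilpotent elements are closed under differences and products. Two
  facts give this.

  First, the complement of the left ideal \<open>S s\<close> is closed under multiplication
  (\<open>free_part_mult_nonzero\<close>). Hence every nilpotent element lies in \<open>S s\<close>. The proof is an induction
  that compares lengths of words (\<open>free_part_mult_not_short\<close>).

  Secondly, right multiplication by \<open>s\<close> is injective, so \<open>x s \<mapsto> s x\<close> is a well-defined ring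
  homomorphism from \<open>S s\<close> to \<open>S\<close>, and \<open>x s\<close> is nilpotent if and only if \<open>s x\<close> is. Starting from a nilpotent
  element, the homomorphism can therefore be applied again and again. Each application removes an
  occurrence of \<open>t\<close> from every word that has one, so after finitely many steps a nilpotent
  element of \<open>\<int>[s]\<close> is reached, and that is zero (\<open>nilpotent_rank_0\<close>). Thus the nilpotent elements are
  the union of the increasing chain of kernels of the iterated homomorphism. Each of these is
  closed under differences and products, and so is their union (\<open>nilpotent_iff_nil_level\<close>).

  Finally \<open>S\<close> is countable, which gives a copy of it whose carrier is a set of natural numbers.
\<close>

section \<open>Normal forms of words modulo \<open>s\<^sup>2 t = s\<close>\<close>

datatype letter = T | P

text \<open>\<open>NF w k\<close> stands for \<open>w s\<^sup>k\<close>, where the letter \<open>P\<close> abbreviates \<open>s t\<close>.\<close>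
datatype nform = NF (word: "letter list") (expo: nat)

text \<open>
  Left multiplication of \<open>w s\<^sup>k\<close> by \<open>s\<close>: since \<open>s p = s\<close>, the letter \<open>s\<close> absorbs each leading \<open>p\<close>; since
  \<open>s t = p\<close>, it stops at the first \<open>t\<close>, or joins \<open>s\<^sup>k\<close> if there is none.
\<close>
fun s_times :: "letter list \<Rightarrow> nat \<Rightarrow> nform" where
  "s_times [] k = NF [] (Suc k)"
| "s_times (T # w) k = NF (P # w) k"
| "s_times (P # w) k = s_times w k"

definition s_mult :: "nform \<Rightarrow> nform" where
  "s_mult m = s_times (word m) (expo m)"

definition prepend :: "letter list \<Rightarrow> nform \<Rightarrow> nform" where
  "prepend u m = NF (u @ word m) (expo m)"

text \<open>
  The product is written additively because that is how the monoid of exponents of a monoid ring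
  \<open>'a \<Rightarrow>\<^sub>0 int\<close> is written. It lets the letters of the left factor act on the right factor;
  associativity then only has to be checked for \<open>s\<close>, where it amounts to \<open>s p = s\<close> and \<open>s t = p\<close>.
\<close>
instantiation nform :: monoid_add
begin

definition zero_nform :: nform where "0 = NF [] 0"

definition plus_nform :: "nform \<Rightarrow> nform \<Rightarrow> nform" where
  "m + n = prepend (word m) ((s_mult ^^ expo m) n)"

instance
proof
  have pre: "prepend u m + n = prepend u (m + n)" for u and m n :: nform
    by (simp add: plus_nform_def prepend_def)
  have sp: "s_mult (prepend (P # w) m) = s_mult (prepend w m)"
    and st: "s_mult (prepend (T # w) m) = prepend (P # w) m" for w and m :: nform
    by (simp_all add: prepend_def s_mult_def)
  have "s_times w k + n = s_mult (NF w k + n)" for w k and n :: nform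
  proof (induction w k rule: s_times.induct)
    case (1 k)
    then show ?case by (simp add: plus_nform_def prepend_def)
  next
    case (2 w k)
    then show ?case by (simp add: plus_nform_def st)
  next
    case (3 w k)
    then show ?case by (simp add: plus_nform_def sp)
  qed
  then have s_mult_plus: "s_mult m + n = s_mult (m + n)" for m n :: nform
    by (metis s_mult_def nform.collapse)
  have pow: "(s_mult ^^ k) m + n = (s_mult ^^ k) (m + n)" for k and m n :: nform
    by (induction k) (simp_all add: s_mult_plus)
  show "a + b + c = a + (b + c)" for a b c :: nform
    by (simp add: plus_nform_def[of a] pre pow)
  show "0 + a = a" for a :: nform
    by (simp add: zero_nform_def plus_nform_def prepend_def)
  have "(s_mult ^^ k) (NF [] 0) = NF [] k" for k
    by (induction k) (simp_all add: s_mult_def)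
  then show "a + 0 = a" for a :: nform
    by (simp add: zero_nform_def plus_nform_def prepend_def)
qed

end

instance letter :: countable by countable_datatype
instance nform :: countable by countable_datatype


lemma s_mult_simps [simp]:
  "s_mult (NF [] k) = NF [] (Suc k)"
  "s_mult (NF (P # w) k) = s_mult (NF w k)"
  "s_mult (NF (T # w) k) = NF (P # w) k"
  by (simp_all add: s_mult_def)

lemma s_mult_funpow: "(s_mult ^^ k) (NF [] j) = NF [] (k + j)"
  by (induction k) simp_all

lemma nform_plus_simps:
  "m + NF [] k = NF (word m) (expo m + k)"
  "NF w 0 + m = NF (w @ word m) (expo m)"
  "NF w (Suc k) + NF [P] 0 = NF w (Suc k)"
  "NF w (Suc 0) + NF [T] 0 = NF (w @ [P]) 0"
  "NF w (Suc (Suc k)) + NF [T] 0 = NF w (Suc k)"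
  "NF [] (Suc 0) + m = s_mult m"
proof -
  have "(s_mult ^^ Suc k) (NF (x # u) 0) = (s_mult ^^ k) (s_mult (NF (x # u) 0))" for x u k
    by (simp only: funpow_Suc_right o_apply)
  then show "NF w (Suc k) + NF [P] 0 = NF w (Suc k)"
    and "NF w (Suc (Suc k)) + NF [T] 0 = NF w (Suc k)"
    by (simp_all add: plus_nform_def prepend_def s_mult_funpow del: funpow.simps)
qed (simp_all add: plus_nform_def prepend_def s_mult_funpow)

section \<open>The ring and its decomposition \<open>S = F \<oplus> S s\<close>\<close>

lemma frag_of_mult: "frag_of m * frag_of n = frag_of (m + n)" for m n :: "'a :: monoid_add"
  by (simp add: mult_single)

lemma frag_of_Nil: "frag_of (NF [] 0) = 1"
  by (simp flip: zero_nform_def)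

type_synonym univ_ring = "nform \<Rightarrow>\<^sub>0 int"

abbreviation s :: univ_ring where "s \<equiv> frag_of (NF [] (Suc 0))"
abbreviation t :: univ_ring where "t \<equiv> frag_of (NF [T] 0)"
abbreviation p :: univ_ring where "p \<equiv> frag_of (NF [P] 0)"

lemma s_eq_s_s_t: "s = s * s * t"
  by (simp add: frag_of_mult nform_plus_simps)

text \<open>The projection of \<open>S\<close> onto \<open>F\<close> along the left ideal \<open>S s\<close>.\<close>
definition free_part :: "univ_ring \<Rightarrow> univ_ring" where
  "free_part = frag_extend (\<lambda>m. if expo m = 0 then frag_of m else 0)"

lemma free_part_add: "free_part (x + y) = free_part x + free_part y"
  and free_part_diff: "free_part (x - y) = free_part x - free_part y"
  and free_part_cmul: "free_part (frag_cmul k x) = frag_cmul k (free_part x)"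
  and free_part_0 [simp]: "free_part 0 = 0"
  and free_part_of: "free_part (frag_of m) = (if expo m = 0 then frag_of m else 0)"
  by (simp_all add: free_part_def frag_extend_add frag_extend_diff frag_extend_cmul)

text \<open>
  The bound is strict, so that \<open>short_words 0\<close> is empty: nothing is shorter than the empty word.
\<close>
definition short_words :: "nat \<Rightarrow> nform set" where
  "short_words n = {m. expo m = 0 \<and> length (word m) < n}"

abbreviation free_words :: "nform set" where
  "free_words \<equiv> {m. expo m = 0}"

lemma keys_diff_le: "Poly_Mapping.keys x \<subseteq> A \<Longrightarrow> Poly_Mapping.keys y \<subseteq> A \<Longrightarrow> Poly_Mapping.keys (x - y) \<subseteq> A"
  for x y :: "'a \<Rightarrow>\<^sub>0 int"
  using keys_diff[of x y] by blast

lemma keys_cmul_le: "Poly_Mapping.keys x \<subseteq> A \<Longrightarrow> Poly_Mapping.keys (frag_cmul k x) \<subseteq> A"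
  using keys_cmul[of k x] by blast

lemma keys_free_part: "Poly_Mapping.keys (free_part x) \<subseteq> free_words"
  using keys_frag_extend[of "\<lambda>m. if expo m = 0 then frag_of m else 0" x]
  by (fastforce simp: free_part_def split: if_splits)

lemma free_part_mult_s [simp]: "free_part (x * s) = 0"
  by (rule frag_induction[of x UNIV])
     (simp_all add: free_part_of free_part_diff left_diff_distrib frag_of_mult nform_plus_simps)

text \<open>
  Multiplication by \<open>p\<close> on the right respects the decomposition \<open>S = F \<oplus> S s\<close>, as \<open>s p = s\<close>. Multiplication
  by \<open>t\<close> does not, because of \<open>s t = p\<close>; but what it moves from \<open>S s\<close> to \<open>F\<close> ends with the letter \<open>p\<close>, so
  it can be told apart from the product of the \<open>F\<close>-part with \<open>t\<close>.
\<close>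
lemma free_part_mult_p: "free_part (x * p) = free_part x * p"
proof (rule frag_induction[of x UNIV])
  fix m show "free_part (frag_of m * p) = free_part (frag_of m) * p"
    by (cases m; cases "expo m")
       (simp_all add: frag_of_mult nform_plus_simps free_part_of)
qed (simp_all add: free_part_diff left_diff_distrib)

lemma free_part_mult_t:
  "\<exists>y. Poly_Mapping.keys y \<subseteq> free_words \<and> free_part (x * t) = free_part x * t + y * p"
proof (rule frag_induction[of x UNIV])
  show "\<exists>y. Poly_Mapping.keys y \<subseteq> free_words \<and> free_part (0 * t) = free_part 0 * t + y * p"
    by (intro exI[of _ 0]) simp
next
  fix m
  obtain w k where m: "m = NF w k" by (cases m)
  consider "k = 0" | "k = Suc 0" | l where "k = Suc (Suc l)"
    by (metis not0_implies_Suc)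
  then show "\<exists>y. Poly_Mapping.keys y \<subseteq> free_words \<and>
      free_part (frag_of m * t) = free_part (frag_of m) * t + y * p"
  proof cases
    case 2
    then show ?thesis
      by (intro exI[of _ "frag_of (NF w 0)"])
         (simp add: m frag_of_mult nform_plus_simps free_part_of)
  qed (intro exI[of _ 0]; simp add: m frag_of_mult nform_plus_simps free_part_of)+
next
  fix a b
  assume "\<exists>y. Poly_Mapping.keys y \<subseteq> free_words \<and> free_part (a * t) = free_part a * t + y * p"
     and "\<exists>y. Poly_Mapping.keys y \<subseteq> free_words \<and> free_part (b * t) = free_part b * t + y * p"
  then obtain y z where "Poly_Mapping.keys y \<subseteq> free_words" "free_part (a * t) = free_part a * t + y * p"
     "Poly_Mapping.keys z \<subseteq> free_words" "free_part (b * t) = free_part b * t + z * p"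
    by blast
  then show "\<exists>y. Poly_Mapping.keys y \<subseteq> free_words \<and>
      free_part ((a - b) * t) = free_part (a - b) * t + y * p"
    by (intro exI[of _ "y - z"]) (auto simp: free_part_diff left_diff_distrib keys_diff_le)
qed simp

text \<open>
  The set \<open>A\<close> allows restrictions on the words \<open>w\<close> to be carried over from \<open>x\<close> to the cofactor of \<open>s\<close>.
\<close>
lemma split_off_s:
  assumes "Poly_Mapping.keys x \<subseteq> A" and "\<And>w k. NF w (Suc k) \<in> A \<Longrightarrow> NF w k \<in> A"
  shows "\<exists>y. Poly_Mapping.keys y \<subseteq> A \<and> x = free_part x + y * s"
  using assms(1)
proof (induction rule: frag_induction)
  case zero
  show ?case by (intro exI[of _ 0]) simp
next
  case (one m)
  obtain w k where m: "m = NF w k" by (cases m)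
  show ?case
  proof (cases k)
    case 0
    then show ?thesis by (intro exI[of _ 0]) (simp add: m free_part_of)
  next
    case (Suc l)
    then show ?thesis using one assms(2)
      by (intro exI[of _ "frag_of (NF w l)"])
         (simp add: m free_part_of frag_of_mult nform_plus_simps)
  qed
next
  case (diff a b)
  then obtain y z where "Poly_Mapping.keys y \<subseteq> A" "a = free_part a + y * s"
     "Poly_Mapping.keys z \<subseteq> A" "b = free_part b + z * s"
    by blast
  moreover from this have "a - b = free_part (a - b) + (y - z) * s"
    unfolding free_part_diff left_diff_distrib by (metis add_diff_add)
  ultimately show ?case
    by (meson keys_diff_le)
qed

section \<open>The complement of \<open>S s\<close> is closed under multiplication\<close>

lemma split_last_letter:
  assumes "Poly_Mapping.keys z \<subseteq> short_words (Suc n)"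
  shows "\<exists>x y k. Poly_Mapping.keys x \<subseteq> short_words n \<and> Poly_Mapping.keys y \<subseteq> short_words n \<and>
           z = x * t + y * p + frag_cmul k 1"
  using assms
proof (induction rule: frag_induction)
  case zero
  show ?case by (intro exI[of _ 0]) simp
next
  case (one m)
  then obtain w where m: "m = NF w 0" and w: "length w < Suc n"
    by (cases m) (auto simp: short_words_def)
  show ?case
  proof (cases w rule: rev_cases)
    case Nil
    then show ?thesis
      by (intro exI[of _ 0] exI[of _ 1]) (simp add: m frag_of_Nil)
  next
    case (snoc u l)
    have "NF u 0 \<in> short_words n" using w by (simp add: short_words_def snoc)
    show ?thesis
    proof (cases l)
      case T
      show ?thesis
        by (rule exI[of _ "frag_of (NF u 0)"], rule exI[of _ 0], rule exI[of _ 0])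
           (use \<open>NF u 0 \<in> short_words n\<close> in \<open>simp add: m snoc T frag_of_mult nform_plus_simps\<close>)
    next
      case P
      show ?thesis
        by (rule exI[of _ 0], rule exI[of _ "frag_of (NF u 0)"], rule exI[of _ 0])
           (use \<open>NF u 0 \<in> short_words n\<close> in \<open>simp add: m snoc P frag_of_mult nform_plus_simps\<close>)
    qed
  qed
next
  case (diff a b)
  then obtain x y k x' y' k' where
    "Poly_Mapping.keys x \<subseteq> short_words n" "Poly_Mapping.keys y \<subseteq> short_words n"
    "a = x * t + y * p + frag_cmul k 1"
    "Poly_Mapping.keys x' \<subseteq> short_words n" "Poly_Mapping.keys y' \<subseteq> short_words n"
    "b = x' * t + y' * p + frag_cmul k' 1"
    by blast
  then show ?case
    by (intro exI[of _ "x - x'"] exI[of _ "y - y'"] exI[of _ "k - k'"])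
       (simp add: keys_diff_le left_diff_distrib frag_cmul_diff_distrib)
qed

lemma lookup_times_letter:
  assumes "Poly_Mapping.keys x \<subseteq> free_words"
  shows "Poly_Mapping.lookup (x * frag_of (NF [l] 0)) (NF w 0) =
           (if w \<noteq> [] \<and> last w = l then Poly_Mapping.lookup x (NF (butlast w) 0) else 0)"
  using assms
proof (induction rule: frag_induction)
  case (one m)
  then obtain u where "m = NF u 0" by (cases m) auto
  then show ?case
    by (cases w rule: rev_cases) (auto simp: frag_of_mult nform_plus_simps)
qed (auto simp: left_diff_distrib lookup_minus)

lemma lookup_1: "Poly_Mapping.lookup (1 :: univ_ring) (NF w 0) = (if w = [] then 1 else 0)"
  by (simp flip: frag_of_Nil)

lemma free_eq_0I:
  assumes "Poly_Mapping.keys x \<subseteq> free_words" "\<And>w. Poly_Mapping.lookup x (NF w 0) = 0"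
  shows "x = (0 :: univ_ring)"
proof (rule poly_mapping_eqI)
  fix m show "Poly_Mapping.lookup x m = Poly_Mapping.lookup 0 m"
  proof (cases "m \<in> Poly_Mapping.keys x")
    case True
    then have "m = NF (word m) 0" using assms(1) by (cases m) auto
    then show ?thesis using assms(2) by (metis lookup_zero)
  qed (simp add: in_keys_iff)
qed

lemma last_letter_unique:
  assumes "Poly_Mapping.keys x \<subseteq> free_words" "Poly_Mapping.keys y \<subseteq> free_words"
    and "x * t + y * p + frag_cmul k 1 = 0"
  shows "x = 0"
proof (rule free_eq_0I[OF assms(1)])
  fix w
  have "Poly_Mapping.lookup (x * t + y * p + frag_cmul k 1) (NF (w @ [T]) 0) = 0"
    by (simp add: assms)
  then show "Poly_Mapping.lookup x (NF w 0) = 0"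
    by (simp add: lookup_add lookup_times_letter assms(1,2) lookup_1)
qed

lemma short_if_times_p_short:
  assumes "Poly_Mapping.keys x \<subseteq> free_words" "Poly_Mapping.keys (x * p) \<subseteq> short_words (Suc d)"
  shows "Poly_Mapping.keys x \<subseteq> short_words d"
proof
  fix m assume m: "m \<in> Poly_Mapping.keys x"
  then have m': "m = NF (word m) 0" using assms(1) by (cases m) auto
  have "Poly_Mapping.lookup (x * p) (NF (word m @ [P]) 0) = Poly_Mapping.lookup x m"
    using m' by (simp add: lookup_times_letter assms)
  then have "NF (word m @ [P]) 0 \<in> Poly_Mapping.keys (x * p)"
    using m by (simp add: in_keys_iff)
  then show "m \<in> short_words d" using assms(2) m' by (cases m) (auto simp: short_words_def)
qed

lemma frag_cmul_diff: "frag_cmul k (x - y) = frag_cmul k x - frag_cmul k y"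
  by (rule poly_mapping_eqI) (simp add: lookup_minus right_diff_distrib)

lemma frag_cmul_eq_times_single:
  "frag_cmul k x = Poly_Mapping.single 0 k * x"
  "frag_cmul k x = x * Poly_Mapping.single 0 k" for x :: univ_ring
proof -
  show "frag_cmul k x = Poly_Mapping.single 0 k * x"
    by (rule frag_induction[of x UNIV])
       (simp_all add: right_diff_distrib frag_cmul_diff mult_single poly_mapping_eqI lookup_single when_def)
  show "frag_cmul k x = x * Poly_Mapping.single 0 k"
    by (rule frag_induction[of x UNIV])
       (simp_all add: left_diff_distrib frag_cmul_diff mult_single poly_mapping_eqI lookup_single when_def)
qed

lemma frag_cmul_mult: "frag_cmul k (x * y) = frag_cmul k x * y" for x y :: univ_ring
  by (simp add: frag_cmul_eq_times_single(1) mult.assoc)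

lemma times_cmul_1: "x * frag_cmul k 1 = frag_cmul k x" for x :: univ_ring
  by (metis frag_cmul_eq_times_single mult_1)

lemma short_mono: "short_words n \<subseteq> short_words (Suc n)" and short_free: "short_words n \<subseteq> free_words" and short_0: "short_words 0 = {}"
  by (auto simp: short_words_def)

text \<open>
  The idea is to compare last letters. Let \<open>a\<close> be the \<open>F\<close>-part of \<open>y\<close>, with words of length at most \<open>d\<close>, and write
  \<open>z = z\<^sub>1 t + z\<^sub>2 p + k\<close>. Then the \<open>F\<close>-part \<open>r\<close> of \<open>y z\<close> is
  \<open>f(y z\<^sub>1) t + (v + f(y z\<^sub>2)) p + k a\<close>,
  where \<open>f\<close> is the projection to \<open>F\<close> and \<open>v\<close> is the contribution of \<open>s t = p\<close>, which vanishes if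
  \<open>z\<^sub>1 = 0\<close>. Suppose that \<open>r\<close> has only words shorter than \<open>d\<close>. Reading off the words that end with \<open>t\<close> shows that
  \<open>f(y z\<^sub>1)\<close> has only words shorter than \<open>d\<close>, because removing the last letter from the words
  of \<open>a\<close> makes them so; by induction \<open>z\<^sub>1 = 0\<close>. Now \<open>f(y z\<^sub>2) p = r - k a\<close> has words of length at most
  \<open>d\<close>, and removing the \<open>p\<close> gives \<open>z\<^sub>2 = 0\<close> in the same way. What is left is \<open>r = k a\<close>, and \<open>a\<close> has a word of
  length \<open>d\<close>, so \<open>k = 0\<close>.
\<close>
lemma free_part_mult_not_short:
  assumes a: "Poly_Mapping.keys (free_part y) \<subseteq> short_words (Suc d)"
      "\<not> Poly_Mapping.keys (free_part y) \<subseteq> short_words d"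
    and "Poly_Mapping.keys z \<subseteq> short_words n" "Poly_Mapping.keys (free_part (y * z)) \<subseteq> short_words d"
  shows "z = 0"
  using assms(3,4)
proof (induction n arbitrary: z)
  case 0
  then show ?case by (simp add: short_0)
next
  case (Suc n)
  define a where "a = free_part y"
  define r where "r = free_part (y * z)"
  obtain z\<^sub>1 z\<^sub>2 k where z\<^sub>1: "Poly_Mapping.keys z\<^sub>1 \<subseteq> short_words n" and z\<^sub>2: "Poly_Mapping.keys z\<^sub>2 \<subseteq> short_words n"
      and z: "z = z\<^sub>1 * t + z\<^sub>2 * p + frag_cmul k 1"
    using split_last_letter[OF Suc.prems(1)] by blast
  obtain v where v: "Poly_Mapping.keys v \<subseteq> free_words"
      "free_part (y * z\<^sub>1 * t) = free_part (y * z\<^sub>1) * t + v * p"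
    using free_part_mult_t by blast
  have r_eq: "r = free_part (y * z\<^sub>1 * t) + free_part (y * z\<^sub>2) * p + frag_cmul k a"
    by (simp add: r_def z a_def distrib_left free_part_add times_cmul_1 free_part_cmul
         flip: mult.assoc free_part_mult_p)
  obtain a\<^sub>1 a\<^sub>2 \<alpha> where a\<^sub>1: "Poly_Mapping.keys a\<^sub>1 \<subseteq> short_words d" and a\<^sub>2: "Poly_Mapping.keys a\<^sub>2 \<subseteq> short_words d"
      and a_eq: "a = a\<^sub>1 * t + a\<^sub>2 * p + frag_cmul \<alpha> 1"
    by (rule split_last_letter[OF a(1), folded a_def, elim_format]) (elim exE conjE, rule that)
  have r: "Poly_Mapping.keys r \<subseteq> short_words d"
    using Suc.prems(2) by (simp add: r_def)
  then have "Poly_Mapping.keys r \<subseteq> short_words (Suc d)"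
    using short_mono by (rule subset_trans)
  then obtain r\<^sub>1 r\<^sub>2 \<rho> where r\<^sub>1: "Poly_Mapping.keys r\<^sub>1 \<subseteq> short_words d" and r\<^sub>2: "Poly_Mapping.keys r\<^sub>2 \<subseteq> short_words d"
      and r_eq': "r = r\<^sub>1 * t + r\<^sub>2 * p + frag_cmul \<rho> 1"
    by (rule split_last_letter[elim_format]) (elim exE conjE, rule that)
  have eq: "r\<^sub>1 * t + r\<^sub>2 * p + frag_cmul \<rho> 1 =
      free_part (y * z\<^sub>1) * t + v * p + free_part (y * z\<^sub>2) * p
        + (frag_cmul k a\<^sub>1 * t + frag_cmul k a\<^sub>2 * p + frag_cmul (k * \<alpha>) 1)"
    (is "?lhs = ?rhs")
    using r_eq unfolding v(2) r_eq' a_eq frag_cmul_distrib2 frag_cmul_mult frag_cmul_cmul .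
  have regroup: "b - (r - c) + (b' + b'' - (r' - c')) + (e - e') =
      b + b' + b'' + (c + c' + e) - (r + r' + e')" for b b' b'' c c' e e' r r' :: univ_ring
    by (simp add: algebra_simps)
  have "free_part (y * z\<^sub>1) - (r\<^sub>1 - frag_cmul k a\<^sub>1) = 0"
  proof (rule last_letter_unique)
    have "(free_part (y * z\<^sub>1) - (r\<^sub>1 - frag_cmul k a\<^sub>1)) * t
        + (v + free_part (y * z\<^sub>2) - (r\<^sub>2 - frag_cmul k a\<^sub>2)) * p
        + frag_cmul (k * \<alpha> - \<rho>) 1 = ?rhs - ?lhs"
      unfolding left_diff_distrib distrib_right frag_cmul_diff_distrib by (rule regroup)
    then show "(free_part (y * z\<^sub>1) - (r\<^sub>1 - frag_cmul k a\<^sub>1)) * t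
        + (v + free_part (y * z\<^sub>2) - (r\<^sub>2 - frag_cmul k a\<^sub>2)) * p
        + frag_cmul (k * \<alpha> - \<rho>) 1 = 0"
      by (simp only: eq diff_self)
    have sub: "Poly_Mapping.keys (x - (y - frag_cmul k z)) \<subseteq> free_words"
      if "Poly_Mapping.keys x \<subseteq> free_words" "Poly_Mapping.keys y \<subseteq> short_words d" "Poly_Mapping.keys z \<subseteq> short_words d" for x y z
      by (rule keys_diff_le[OF that(1) keys_diff_le[OF subset_trans[OF that(2) short_free]
              keys_cmul_le[OF subset_trans[OF that(3) short_free]]]])
    have "Poly_Mapping.keys (v + free_part (y * z\<^sub>2)) \<subseteq> free_words"
      using v(1) keys_free_part[of "y * z\<^sub>2"] keys_add[of v "free_part (y * z\<^sub>2)"] by blast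
    then show "Poly_Mapping.keys (v + free_part (y * z\<^sub>2) - (r\<^sub>2 - frag_cmul k a\<^sub>2)) \<subseteq> free_words"
      by (intro sub a\<^sub>2 r\<^sub>2)
    show "Poly_Mapping.keys (free_part (y * z\<^sub>1) - (r\<^sub>1 - frag_cmul k a\<^sub>1)) \<subseteq> free_words"
      by (intro sub keys_free_part a\<^sub>1 r\<^sub>1)
  qed
  then have "free_part (y * z\<^sub>1) = r\<^sub>1 - frag_cmul k a\<^sub>1"
    by (simp only: right_minus_eq)
  then have "Poly_Mapping.keys (free_part (y * z\<^sub>1)) \<subseteq> short_words d"
    by (simp only: keys_diff_le[OF r\<^sub>1 keys_cmul_le[OF a\<^sub>1]])
  then have z\<^sub>1_0: "z\<^sub>1 = 0"
    by (rule Suc.IH[OF z\<^sub>1])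
  have B: "free_part (y * z\<^sub>2) * p = r - frag_cmul k a"
    unfolding r_eq z\<^sub>1_0 by simp
  have "Poly_Mapping.keys (r - frag_cmul k a) \<subseteq> short_words (Suc d)"
    by (rule keys_diff_le[OF subset_trans[OF r short_mono] keys_cmul_le[OF a(1)[folded a_def]]])
  then have "Poly_Mapping.keys (free_part (y * z\<^sub>2)) \<subseteq> short_words d"
    unfolding B[symmetric] by (rule short_if_times_p_short[OF keys_free_part])
  then have z\<^sub>2_0: "z\<^sub>2 = 0"
    by (rule Suc.IH[OF z\<^sub>2])
  have "r = frag_cmul k a"
    unfolding r_eq z\<^sub>1_0 z\<^sub>2_0 by simp
  have "k = 0"
  proof (rule ccontr)
    assume "k \<noteq> 0"
    then have "Poly_Mapping.keys a = Poly_Mapping.keys r"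
      unfolding \<open>r = frag_cmul k a\<close> by auto
    then show False
      using r a(2) by (simp add: a_def)
  qed
  then show "z = 0"
    by (simp add: z z\<^sub>1_0 z\<^sub>2_0)
qed

lemma ex_short:
  assumes "Poly_Mapping.keys x \<subseteq> free_words"
  shows "\<exists>n. Poly_Mapping.keys x \<subseteq> short_words n"
proof -
  have "Poly_Mapping.keys x \<subseteq> short_words (Suc (Max ((\<lambda>m. length (word m)) ` Poly_Mapping.keys x)))"
    using assms by (auto simp: short_words_def less_Suc_eq_le)
  then show ?thesis ..
qed

text \<open>
  Only the \<open>F\<close>-part of the right factor matters modulo \<open>S s\<close>, so \<open>free_part_mult_not_short\<close> applies with
  \<open>d\<close> the length of the longest word in the \<open>F\<close>-part of \<open>x\<close>.
\<close>
lemma free_part_mult_nonzero: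
  assumes "free_part x \<noteq> 0" "free_part y \<noteq> 0"
  shows "free_part (x * y) \<noteq> 0"
proof
  assume 0: "free_part (x * y) = 0"
  obtain y' where y: "y = free_part y + y' * s"
    using split_off_s[of y UNIV] by auto
  have "free_part (x * y) = free_part (x * free_part y) + free_part (x * y' * s)"
    by (subst y) (simp only: distrib_left free_part_add mult.assoc)
  then have 0: "free_part (x * free_part y) = 0"
    using 0 by simp
  define d where "d = (LEAST n. Poly_Mapping.keys (free_part x) \<subseteq> short_words n)"
  have d: "Poly_Mapping.keys (free_part x) \<subseteq> short_words d"
    unfolding d_def by (rule LeastI_ex[OF ex_short[OF keys_free_part]])
  with assms(1) have "d \<noteq> 0"
    by (metis short_0 keys_eq_empty subset_empty)
  then obtain d' where d': "d = Suc d'"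
    by (metis not0_implies_Suc)
  have "\<not> Poly_Mapping.keys (free_part x) \<subseteq> short_words d'"
    using not_less_Least[of d' "\<lambda>n. Poly_Mapping.keys (free_part x) \<subseteq> short_words n"] d'
    unfolding d_def by simp
  moreover obtain n where "Poly_Mapping.keys (free_part y) \<subseteq> short_words n"
    using ex_short[OF keys_free_part] by blast
  ultimately have "free_part y = 0"
    using free_part_mult_not_short[of x d' "free_part y" n] d 0 by (simp add: d')
  with assms(2) show False ..
qed

lemma free_part_1: "free_part 1 = 1"
  by (metis free_part_of frag_of_Nil nform.sel(2))

lemma free_part_nilpotent:
  assumes "x ^ n = 0"
  shows "free_part x = 0"
proof (rule ccontr)
  assume "free_part x \<noteq> 0"
  then have "free_part (x ^ n) \<noteq> 0" for n
    by (induction n) (simp_all add: free_part_1 free_part_mult_nonzero)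
  with assms show False
    by (metis free_part_0)
qed

section \<open>An increasing chain of nil subrings\<close>

lemma power_swap: "(x * y) ^ Suc n = x * (y * x) ^ n * y" for x y :: "'a :: monoid_mult"
proof (induction n)
  case (Suc n)
  have "(x * y) ^ Suc (Suc n) = (x * y) ^ Suc n * (x * y)"
    by (rule power_Suc2)
  also have "\<dots> = x * ((y * x) ^ n * (y * x)) * y"
    by (simp only: Suc mult.assoc)
  finally show ?case by (simp only: power_Suc2)
qed simp

text \<open>
  \<open>nil_level n\<close> is the kernel of the \<open>n\<close>-fold iterate of the partial homomorphism \<open>x s \<mapsto> s x\<close>. Taking
  the kernels as successive inverse images avoids iterating a map that is defined only on \<open>S s\<close>.
\<close>
fun nil_level :: "nat \<Rightarrow> univ_ring set" where
  "nil_level 0 = {0}"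
| "nil_level (Suc n) = {x * s | x. s * x \<in> nil_level n}"

text \<open>
  Multiplicativity of \<open>x s \<mapsto> s x\<close>: the product \<open>(x s) (y s) = (x s y) s\<close> goes to \<open>s x s y = (s x) (s y)\<close>.
\<close>
lemma nil_level_subring:
  shows "0 \<in> nil_level n"
    and "x \<in> nil_level n \<Longrightarrow> y \<in> nil_level n \<Longrightarrow> x - y \<in> nil_level n"
    and "x \<in> nil_level n \<Longrightarrow> y \<in> nil_level n \<Longrightarrow> x * y \<in> nil_level n"
proof (induction n arbitrary: x y)
  case (Suc n)
  {
    case 1
    show ?case using Suc(1) by (auto intro!: exI[of _ 0])
  next
    case 2
    then obtain x' y' where "x = x' * s" "s * x' \<in> nil_level n" "y = y' * s" "s * y' \<in> nil_level n"
      by auto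
    then show ?case
      using Suc(2) by (auto intro!: exI[of _ "x' - y'"] simp: algebra_simps)
  next
    case 3
    then obtain x' y' where "x = x' * s" "s * x' \<in> nil_level n" "y = y' * s" "s * y' \<in> nil_level n"
      by auto
    moreover from this have "s * x' * (s * y') \<in> nil_level n"
      using Suc(3) by blast
    ultimately show ?case
      by (auto intro!: exI[of _ "x' * s * y'"] simp: mult.assoc)
  }
qed auto

lemma nil_level_Suc: "nil_level n \<subseteq> nil_level (Suc n)"
proof (induction n)
  case 0
  show ?case by (auto intro: exI[of _ 0])
next
  case (Suc n)
  then show ?case by auto
qed

lemma nil_level_nilpotent: "x \<in> nil_level n \<Longrightarrow> \<exists>k. x ^ Suc k = 0"
proof (induction n arbitrary: x)
  case (Suc n)
  then obtain y where x: "x = y * s" and "s * y \<in> nil_level n"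
    by auto
  then obtain k where "(s * y) ^ Suc k = 0"
    using Suc.IH by blast
  then have "x ^ Suc (Suc k) = 0"
    unfolding x power_swap by simp
  then show ?case ..
qed simp

section \<open>Every nilpotent element lies in the chain\<close>

text \<open>
  Left multiplication by \<open>s\<close> removes a \<open>t\<close> from a word that has one, and turns a power of \<open>p\<close> into the empty
  word. Counting the latter as one more step, rank zero characterises the powers of \<open>s\<close>.
\<close>
fun t_rank :: "letter list \<Rightarrow> nat" where
  "t_rank [] = 0"
| "t_rank w = Suc (count_list w T)"

lemma t_rank_s_mult: "t_rank (word (s_mult m)) \<le> t_rank (word m) - 1"
proof -
  have "t_rank (word (s_times w k)) \<le> t_rank w - 1" for w k
  proof (induction w k rule: s_times.induct)
    case (3 w k)
    then show ?case by (cases w) auto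
  qed auto
  then show ?thesis by (simp add: s_mult_def)
qed

lemma keys_s_times:
  assumes "Poly_Mapping.keys x \<subseteq> {m. t_rank (word m) \<le> n}"
  shows "Poly_Mapping.keys (s * x) \<subseteq> {m. t_rank (word m) \<le> n - 1}"
  using assms
proof (induction rule: frag_induction)
  case (one m)
  then show ?case
    using t_rank_s_mult[of m] by (auto simp: frag_of_mult nform_plus_simps)
qed (simp_all only: right_diff_distrib keys_diff_le, simp_all)

lemma nilpotent_split_s:
  fixes x :: univ_ring
  assumes "x ^ k = 0" "Poly_Mapping.keys x \<subseteq> {m. t_rank (word m) \<le> n}"
  obtains y where "x = y * s" "Poly_Mapping.keys y \<subseteq> {m. t_rank (word m) \<le> n}"
proof -
  obtain y where "Poly_Mapping.keys y \<subseteq> {m. t_rank (word m) \<le> n}" "x = free_part x + y * s"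
    using split_off_s[OF assms(2)] by auto
  with free_part_nilpotent[OF assms(1)] that show thesis by simp
qed

lemma keys_mult_s_power: "Poly_Mapping.keys (x * s ^ k) \<subseteq> {m. k \<le> expo m}"
proof (induction k)
  case (Suc k)
  then have "Poly_Mapping.keys (x * s ^ k * s) \<subseteq> {m. Suc k \<le> expo m}"
  proof (induction rule: frag_induction)
    case (diff a b)
    then show ?case unfolding left_diff_distrib by (rule keys_diff_le)
  qed (simp_all add: frag_of_mult nform_plus_simps)
  then show ?case by (simp add: power_Suc2 mult.assoc del: power_Suc)
qed simp

lemma mult_s_eq_0:
  assumes "x * s = 0"
  shows "x = 0"
proof (rule poly_mapping_eqI)
  have "Poly_Mapping.lookup (x * s) (NF w (Suc k)) = Poly_Mapping.lookup x (NF w k)" for w k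
  proof (rule frag_induction[of x UNIV])
    fix m show "Poly_Mapping.lookup (frag_of m * s) (NF w (Suc k)) = Poly_Mapping.lookup (frag_of m) (NF w k)"
      by (cases m) (simp add: frag_of_mult nform_plus_simps lookup_frag_of)
  qed (simp_all add: left_diff_distrib lookup_minus)
  then show "Poly_Mapping.lookup x m = Poly_Mapping.lookup 0 m" for m
    using assms by (metis lookup_zero nform.collapse)
qed

lemma mult_s_power_eq_0: "x * s ^ n = 0 \<Longrightarrow> x = 0"
proof (induction n)
  case (Suc n)
  have "x * s ^ n * s = 0"
    using Suc.prems by (simp only: power_Suc2 mult.assoc)
  then show ?case
    using mult_s_eq_0 Suc.IH by blast
qed simp

lemma rank_0_commutes_s:
  assumes "Poly_Mapping.keys x \<subseteq> {m. t_rank (word m) \<le> 0}"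
  shows "s * x = x * s"
  using assms
proof (induction rule: frag_induction)
  case (one m)
  then obtain k where "m = NF [] k"
    by (cases m; cases "word m") auto
  then show ?case
    by (simp add: frag_of_mult nform_plus_simps)
qed (simp_all add: algebra_simps)

text \<open>
  The elements of rank zero form the commutative ring \<open>\<int>[s]\<close>. If \<open>z s\<close> is a nilpotent element of it, then so
  is \<open>z\<close>, because \<open>s\<close> can be cancelled. As nilpotent elements are divisible by \<open>s\<close>, they are divisible by
  every power of \<open>s\<close>, which leaves only zero.
\<close>
lemma nilpotent_rank_0:
  fixes x :: univ_ring
  assumes "x ^ n = 0" "Poly_Mapping.keys x \<subseteq> {m. t_rank (word m) \<le> 0}"
  shows "x = 0"
proof -
  have *: "\<exists>y. x = y * s ^ k \<and> y ^ n = 0 \<and> Poly_Mapping.keys y \<subseteq> {m. t_rank (word m) \<le> 0}" for k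
  proof (induction k)
    case 0
    show ?case using assms by (intro exI[of _ x]) auto
  next
    case (Suc k)
    then obtain y where y: "x = y * s ^ k" "y ^ n = 0" "Poly_Mapping.keys y \<subseteq> {m. t_rank (word m) \<le> 0}"
      by blast
    obtain z where z: "y = z * s" "Poly_Mapping.keys z \<subseteq> {m. t_rank (word m) \<le> 0}"
      using nilpotent_split_s[OF y(2,3)] .
    have s_z: "z ^ i * s = s * z ^ i" for i
      by (rule power_commuting_commutes) (rule rank_0_commutes_s[OF z(2), symmetric])
    have "(z * s) ^ i = z ^ i * s ^ i" for i
    proof (induction i)
      case (Suc i)
      have "(z * s) ^ Suc i = z * (s * z ^ i) * s ^ i"
        by (simp only: power_Suc Suc mult.assoc)
      also have "\<dots> = z ^ Suc i * s ^ Suc i"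
        by (simp only: power_Suc s_z[symmetric] mult.assoc)
      finally show ?case .
    qed simp
    then have "z ^ n = 0"
      using mult_s_power_eq_0[of "z ^ n" n] y(2) unfolding z(1) by simp
    moreover have "x = z * s ^ Suc k"
      unfolding y(1) z(1) by (simp only: power_Suc mult.assoc)
    ultimately show ?case
      using z(2) by blast
  qed
  have "m \<notin> Poly_Mapping.keys x" for m
  proof -
    obtain y where "x = y * s ^ Suc (expo m)"
      using * by blast
    then have "Poly_Mapping.keys x \<subseteq> {m'. Suc (expo m) \<le> expo m'}"
      by (simp only: keys_mult_s_power)
    then show ?thesis by auto
  qed
  then have "Poly_Mapping.keys x = {}" by blast
  then show ?thesis by simp
qed

lemma nilpotent_in_nil_level:
  fixes x :: univ_ring
  assumes "x ^ k = 0" "Poly_Mapping.keys x \<subseteq> {m. t_rank (word m) \<le> n}"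
  shows "\<exists>j. x \<in> nil_level j"
  using assms
proof (induction n arbitrary: x k)
  case 0
  then have "x \<in> nil_level 0" using nilpotent_rank_0 by simp
  then show ?case ..
next
  case (Suc n)
  obtain y where y: "x = y * s" "Poly_Mapping.keys y \<subseteq> {m. t_rank (word m) \<le> Suc n}"
    using nilpotent_split_s[OF Suc.prems] .
  have "(s * y) ^ Suc k = 0"
    using Suc.prems(1) unfolding power_swap y(1) by simp
  moreover have "Poly_Mapping.keys (s * y) \<subseteq> {m. t_rank (word m) \<le> n}"
    using keys_s_times[OF y(2)] by simp
  ultimately obtain j where "s * y \<in> nil_level j"
    using Suc.IH by blast
  then have "x \<in> nil_level (Suc j)"
    using y(1) by auto
  then show ?case ..
qed

lemma nilpotent_iff_nil_level: "(\<exists>k\<ge>1. x ^ k = 0) \<longleftrightarrow> (\<exists>n. x \<in> nil_level n)"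
proof
  assume "\<exists>k\<ge>1. x ^ k = 0"
  moreover have "Poly_Mapping.keys x \<subseteq> {m. t_rank (word m) \<le> Max ((\<lambda>m. t_rank (word m)) ` Poly_Mapping.keys x)}"
    by auto
  ultimately show "\<exists>n. x \<in> nil_level n"
    using nilpotent_in_nil_level by blast
next
  assume "\<exists>n. x \<in> nil_level n"
  then obtain k where "x ^ Suc k = 0"
    using nil_level_nilpotent by blast
  then show "\<exists>k\<ge>1. x ^ k = 0"
    by (intro exI[of _ "Suc k"]) simp
qed

lemma nilpotent_pair_in_nil_level:
  assumes "\<exists>k\<ge>1. x ^ k = 0" "\<exists>k\<ge>1. y ^ k = 0"
  obtains n where "x \<in> nil_level n" "y \<in> nil_level n"
proof -
  obtain i j where "x \<in> nil_level i" "y \<in> nil_level j"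
    using assms unfolding nilpotent_iff_nil_level by blast
  then have "x \<in> nil_level (max i j)" "y \<in> nil_level (max i j)"
    using lift_Suc_mono_le[of nil_level, OF nil_level_Suc] by (meson max.cobounded1 max.cobounded2 subsetD)+
  then show thesis using that by blast
qed

lemma s_not_left_strongly_regular: "s \<noteq> x * s ^ 2"
proof
  assume "s = x * s ^ 2"
  then have "Poly_Mapping.keys s \<subseteq> {m. 2 \<le> expo m}"
    using keys_mult_s_power[of x 2] by simp
  then show False by simp
qed

section \<open>A copy with carrier in the natural numbers\<close>

instance poly_mapping :: (countable, "{countable, zero}") countable
proof
  define graph where "graph x = (\<lambda>k. (k, Poly_Mapping.lookup x k)) ` Poly_Mapping.keys x" for x :: "'a \<Rightarrow>\<^sub>0 'b"
  have "inj graph"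
  proof
    fix x y assume "graph x = graph y"
    then have *: "(k, v) \<in> graph x \<longleftrightarrow> (k, v) \<in> graph y" for k v
      by simp
    have "Poly_Mapping.lookup x k = Poly_Mapping.lookup y k" for k
      using *[of k "Poly_Mapping.lookup x k"] *[of k "Poly_Mapping.lookup y k"]
      by (auto simp: graph_def in_keys_iff image_iff)
    then show "x = y" by (rule poly_mapping_eqI)
  qed
  moreover have "countable (range graph)"
    by (rule countable_subset[OF _ countable_Collect_finite]) (auto simp: graph_def)
  ultimately have "countable (UNIV :: ('a \<Rightarrow>\<^sub>0 'b) set)"
    using countable_image_inj_on by blast
  then show "\<exists>f :: ('a \<Rightarrow>\<^sub>0 'b) \<Rightarrow> nat. inj f"
    by (auto simp: countable_def)
qed

definition nat_copy :: "'a :: {countable, ring_1} itself \<Rightarrow> nat ring" where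
  "nat_copy _ = \<lparr>carrier = range (to_nat :: 'a \<Rightarrow> nat),
     monoid.mult = (\<lambda>a b. to_nat (from_nat a * from_nat b :: 'a)), one = to_nat (1 :: 'a),
     ring.zero = to_nat (0 :: 'a), ring.add = (\<lambda>a b. to_nat (from_nat a + from_nat b :: 'a))\<rparr>"

context
  fixes R :: "nat ring" and \<iota> :: "'a :: {countable, ring_1} \<Rightarrow> nat"
  defines "R \<equiv> nat_copy TYPE('a)" and "\<iota> \<equiv> to_nat"
begin

lemma nat_copy_simps:
  "carrier R = range \<iota>" "\<iota> x \<otimes>\<^bsub>R\<^esub> \<iota> y = \<iota> (x * y)" "\<iota> x \<oplus>\<^bsub>R\<^esub> \<iota> y = \<iota> (x + y)"
  "\<one>\<^bsub>R\<^esub> = \<iota> 1" "\<zero>\<^bsub>R\<^esub> = \<iota> 0" "\<iota> x = \<iota> y \<longleftrightarrow> x = y"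
  by (simp_all add: R_def \<iota>_def nat_copy_def)

lemma ring_nat_copy: "ring R"
proof (rule ringI)
  show "abelian_group R"
  proof (rule abelian_groupI)
    fix a assume "a \<in> carrier R"
    then obtain x where "a = \<iota> x" by (auto simp: nat_copy_simps)
    then show "\<exists>b\<in>carrier R. b \<oplus>\<^bsub>R\<^esub> a = \<zero>\<^bsub>R\<^esub>"
      by (intro bexI[of _ "\<iota> (- x)"]) (auto simp: nat_copy_simps)
  qed (auto simp: nat_copy_simps algebra_simps)
  show "Group.monoid R"
    by (rule monoidI) (auto simp: nat_copy_simps algebra_simps)
qed (auto simp: nat_copy_simps algebra_simps)

lemma nat_copy_pow: "\<iota> x [^]\<^bsub>R\<^esub> (n :: nat) = \<iota> (x ^ n)"
proof -
  interpret ring R by (rule ring_nat_copy)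
  show ?thesis
    by (induction n) (simp_all add: nat_copy_simps power_commutes)
qed

lemma nat_copy_a_inv: "\<ominus>\<^bsub>R\<^esub> \<iota> x = \<iota> (- x)"
proof -
  interpret ring R by (rule ring_nat_copy)
  show ?thesis
    by (rule minus_equality) (simp_all add: nat_copy_simps)
qed

lemma NR_nat_copy:
  assumes "\<And>x y :: 'a. \<exists>k\<ge>1. x ^ k = 0 \<Longrightarrow> \<exists>k\<ge>1. y ^ k = 0 \<Longrightarrow>
     (\<exists>k\<ge>1. (x - y) ^ k = 0) \<and> (\<exists>k\<ge>1. (x * y) ^ k = 0)"
  shows "NR_ring R"
proof -
  interpret ring R by (rule ring_nat_copy)
  define N where "N = {x :: 'a. \<exists>k\<ge>1. x ^ k = 0}"
  have N: "nilpotent_elements R = \<iota> ` N"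
    by (auto simp: nilpotent_elements_def N_def nat_copy_simps nat_copy_pow intro!: imageI)
  have "0 \<in> N"
    by (auto simp: N_def intro!: exI[of _ 1])
  have diff: "x - y \<in> N" and mult: "x * y \<in> N" if "x \<in> N" "y \<in> N" for x y
    using assms that by (auto simp: N_def)
  have minus: "- x \<in> N" if "x \<in> N" for x
    using diff[OF \<open>0 \<in> N\<close> that] by simp
  have add: "x + y \<in> N" if "x \<in> N" "y \<in> N" for x y
    using diff[OF that(1) minus[OF that(2)]] by simp
  have "additive_subgroup (\<iota> ` N) R"
  proof (rule additive_subgroup.intro, rule subgroup.intro)
    show "inv\<^bsub>add_monoid R\<^esub> a \<in> \<iota> ` N" if "a \<in> \<iota> ` N" for a
      using that minus nat_copy_a_inv by (auto simp: a_inv_def)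
  qed (use \<open>0 \<in> N\<close> add in \<open>auto simp: nat_copy_simps\<close>)
  then show ?thesis
    using ring_nat_copy mult by (auto simp: NR_ring_def nonunital_subring_def N nat_copy_simps)
qed

lemma not_right_Dischinger_nat_copy:
  assumes "(x :: 'a) = x ^ 2 * y" "\<And>z. x \<noteq> z * x ^ 2"
  shows "\<not> right_Dischinger R"
proof -
  have "right_strongly_regular R (\<iota> x)"
    unfolding right_strongly_regular_def nat_copy_pow
    using assms(1) by (auto simp: nat_copy_simps)
  moreover have "\<not> left_strongly_regular R (\<iota> x)"
    unfolding left_strongly_regular_def nat_copy_pow
    using assms(2) by (auto simp: nat_copy_simps)
  moreover have "\<iota> x \<in> carrier R"
    by (simp add: nat_copy_simps)
  ultimately show ?thesis
    unfolding right_Dischinger_def strongly_regular_def by blast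
qed

end

section \<open>The example\<close>

theorem corollary3p5:
  "\<exists>R :: nat ring. NR_ring R \<and> \<not> right_Dischinger R"
proof (intro exI conjI)
  show "NR_ring (nat_copy TYPE(univ_ring))"
  proof (rule NR_nat_copy)
    fix x y :: univ_ring
    assume "\<exists>k\<ge>1. x ^ k = 0" "\<exists>k\<ge>1. y ^ k = 0"
    then obtain n where "x \<in> nil_level n" "y \<in> nil_level n"
      by (rule nilpotent_pair_in_nil_level)
    then show "(\<exists>k\<ge>1. (x - y) ^ k = 0) \<and> (\<exists>k\<ge>1. (x * y) ^ k = 0)"
      unfolding nilpotent_iff_nil_level using nil_level_subring by blast
  qed
  show "\<not> right_Dischinger (nat_copy TYPE(univ_ring))"
    by (rule not_right_Dischinger_nat_copy[of s t])
       (simp_all only: power2_eq_square flip: s_eq_s_s_t, use s_not_left_strongly_regular in \<open>simp add: power2_eq_square\<close>)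
qed

end
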